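(* Let $L$ be a locally compact frame and let $e\colon L\to L^\delta$ be a canonical extension of $L$. Then $L^\delta$ is a completely distributive lattice.
   Context: The axiom of choice is assumed. A frame is a complete lattice in which finite meets distribute over arbitrary joins. For $a,c$ in a frame $L$, $c\ll a$ means: for every directed $D\subseteq L$, $a\le\bigvee D$ implies $c\le d$ for some $d\in D$. $L$ is locally compact (continuous) if $a=\bigvee\{c\mid c\ll a\}$, a directed join, for every $a\in L$. A filter of $L$ is an upset closed under finite meets (the improper filter is allowed). A filter $\kappa\subseteq L$ is Scott-open if, whenever $D\subseteq L$ is directed and $\bigvee D\in\kappa$, then $d\in\kappa$ for some $d\in D$. $L^{\wedge}$ denotes the set of Scott-open filters of $L$, ordered by reverse inclusion. A canonical extension of a frame $L$ is a monotone map $e\colon L\to L^\delta$ into a complete lattice $L^\delta$ such that: (Dense) for all $u,v\in L^\delta$: $u\le v$ holds provided that for all $\kappa\in L^{\wedge}$ and $a\in L$, the inequalities $\bigwedge e[\kappa]\le u$ and $v\le e(a)$ together imply $\bigwedge e[\kappa]\le e(a)$; (Compact) if $\bigwedge e[\kappa]\le e(a)$ for some $\kappa\in L^{\wedge}$ and $a\in L$, then $a\in\kappa$. Every frame has a canonical extension, unique up to isomorphism. *)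

theory Defs
  imports Main
begin

class frame = complete_lattice +
  assumes inf_Sup_distrib: "inf a (Sup B) = Sup (inf a ` B)"

context order
begin

definition directed :: "'a set \<Rightarrow> bool" where
  "directed D \<longleftrightarrow> D \<noteq> {} \<and> (\<forall>x\<in>D. \<forall>y\<in>D. \<exists>z\<in>D. x \<le> z \<and> y \<le> z)"

end

context complete_lattice
begin

definition way_below :: "'a \<Rightarrow> 'a \<Rightarrow> bool" (infix \<open>\<lless>\<close> 50) where
  "c \<lless> a \<longleftrightarrow> (\<forall>D. directed D \<longrightarrow> a \<le> Sup D \<longrightarrow> (\<exists>d\<in>D. c \<le> d))"

text \<open>The condition \<open>top \<in> F\<close> is closure under the empty meet. Since \<open>F = UNIV\<close> is allowed,
  the improper filter is included.\<close>

definition lattice_filter :: "'a set \<Rightarrow> bool" where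
  "lattice_filter F \<longleftrightarrow>
     (\<forall>x\<in>F. \<forall>y. x \<le> y \<longrightarrow> y \<in> F) \<and> top \<in> F \<and> (\<forall>x\<in>F. \<forall>y\<in>F. inf x y \<in> F)"

definition scott_open_filters :: "'a set set" where
  "scott_open_filters =
     {\<kappa>. lattice_filter \<kappa> \<and> (\<forall>D. directed D \<longrightarrow> Sup D \<in> \<kappa> \<longrightarrow> (\<exists>d\<in>D. d \<in> \<kappa>))}"

end

class locally_compact_frame = frame +
  assumes directed_way_below: "directed {c. c \<lless> a}"
    and Sup_way_below: "a = Sup {c. c \<lless> a}"

locale canonical_extension =
  fixes e :: "'a::frame \<Rightarrow> 'b::complete_lattice"
  assumes monotone_map: "mono e"
    and dense_map:
      "\<And>u v. (\<And>\<kappa> a. \<lbrakk>\<kappa> \<in> scott_open_filters; Inf (e ` \<kappa>) \<le> u; v \<le> e a\<rbrakk> \<Longrightarrow> Inf (e ` \<kappa>) \<le> e a)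
        \<Longrightarrow> u \<le> v"
    and compact_map:
      "\<And>\<kappa> a. \<lbrakk>\<kappa> \<in> scott_open_filters; Inf (e ` \<kappa>) \<le> e a\<rbrakk> \<Longrightarrow> a \<in> \<kappa>"

end

theory Submission
  imports Defs
begin

text \<open>Suppose \<open>u \<le> v\<close> fails in the canonical extension. Density yields a Scott-open filter \<open>\<kappa>\<close> with
  \<open>\<Sqinter> e[\<kappa>] \<le> u\<close> and \<open>a \<notin> \<kappa>\<close> with \<open>v \<le> e a\<close>. By Zorn's lemma, \<open>a\<close> lies below a maximal element \<open>p\<close>
  of the complement of \<open>\<kappa>\<close>, and \<open>p\<close> is meet-prime, so \<open>\<mu> = {b. \<not> b \<le> p}\<close> is the largest
  Scott-open filter that omits \<open>p\<close>. By density, every \<open>x\<close> satisfies \<open>x \<le> e p\<close> or \<open>\<Sqinter> e[\<mu>] \<le> x\<close>.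
  Hence \<open>u\<close> and \<open>v\<close> are separated by the pair \<open>e p\<close>, \<open>\<Sqinter> e[\<mu>]\<close>, which is Raney's criterion
  for complete distributivity.\<close>

text \<open>Each \<open>Y\<close> in \<open>A\<close> has a member above \<open>p\<close>, since
  otherwise all of \<open>Y\<close>, and hence \<open>Sup Y\<close>, would lie below
  \<open>q\<close>. Choosing such members gives a selection whose meet is above
  \<open>p\<close>.\<close>

lemma complete_distrib_lattice_if_separated:
  assumes sep: "\<And>u v :: 'b::complete_lattice. \<not> u \<le> v \<Longrightarrow>
    \<exists>p q. \<not> u \<le> q \<and> \<not> p \<le> v \<and> (\<forall>x. p \<le> x \<or> x \<le> q)"
  shows "class.complete_distrib_lattice (Inf :: 'b set \<Rightarrow> 'b) Sup inf (\<le>) (<) sup bot top"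
proof (intro class.complete_distrib_lattice.intro class.complete_distrib_lattice_axioms.intro)
  show "class.complete_lattice (Inf :: 'b set \<Rightarrow> 'b) Sup inf (\<le>) (<) sup bot top"
    by (rule complete_lattice_class.complete_lattice_axioms)
next
  fix A :: "'b set set"
  let ?v = "Sup (Inf ` {f ` A |f. \<forall>Y\<in>A. f Y \<in> Y})"
  show "Inf (Sup ` A) \<le> ?v"
  proof (rule ccontr)
    assume "\<not> Inf (Sup ` A) \<le> ?v"
    then obtain p q where pq: "\<not> Inf (Sup ` A) \<le> q" "\<not> p \<le> ?v" "\<And>x. p \<le> x \<or> x \<le> q"
      using sep by blast
    have "\<exists>y\<in>Y. p \<le> y" if "Y \<in> A" for Y
    proof (rule ccontr)
      assume "\<not> (\<exists>y\<in>Y. p \<le> y)"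
      then have "Sup Y \<le> q"
        using pq(3) by (intro Sup_least) blast
      then show False
        using pq(1) that by (meson INF_lower order_trans)
    qed
    then obtain f where f: "\<And>Y. Y \<in> A \<Longrightarrow> f Y \<in> Y \<and> p \<le> f Y"
      by metis
    have "p \<le> Inf (f ` A)"
      using f by (auto intro: INF_greatest)
    also have "\<dots> \<le> ?v"
      using f by (intro Sup_upper) blast
    finally show False
      using pq(2) by blast
  qed
qed

lemma scott_open_filter_top: "\<kappa> \<in> scott_open_filters \<Longrightarrow> top \<in> \<kappa>"
  by (simp add: scott_open_filters_def lattice_filter_def)

lemma scott_open_filter_up: "\<kappa> \<in> scott_open_filters \<Longrightarrow> x \<in> \<kappa> \<Longrightarrow> x \<le> y \<Longrightarrow> y \<in> \<kappa>"
  by (auto simp: scott_open_filters_def lattice_filter_def)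

lemma scott_open_filter_inf: "\<kappa> \<in> scott_open_filters \<Longrightarrow> x \<in> \<kappa> \<Longrightarrow> y \<in> \<kappa> \<Longrightarrow> inf x y \<in> \<kappa>"
  by (auto simp: scott_open_filters_def lattice_filter_def)

lemma scott_open_filter_Sup:
  "\<kappa> \<in> scott_open_filters \<Longrightarrow> directed D \<Longrightarrow> Sup D \<in> \<kappa> \<Longrightarrow> \<exists>d\<in>D. d \<in> \<kappa>"
  by (auto simp: scott_open_filters_def)

lemma frame_inf_sup_distrib: "inf a (sup b c) = sup (inf a b) (inf a (c :: 'a::frame))"
  using inf_Sup_distrib[of a "{b, c}"] by simp

lemma ex_maximal_not_in_scott_open_filter:
  fixes a :: "'a::complete_lattice"
  assumes \<kappa>: "\<kappa> \<in> scott_open_filters" and a: "a \<notin> \<kappa>"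
  obtains p where "a \<le> p" "p \<notin> \<kappa>" "\<And>b. p \<le> b \<Longrightarrow> b \<notin> \<kappa> \<Longrightarrow> b = p"
proof -
  let ?A = "{b. a \<le> b \<and> b \<notin> \<kappa>}"
  have "\<exists>m\<in>?A. \<forall>b\<in>?A. m \<le> b \<longrightarrow> b = m"
  proof (rule predicate_Zorn)
    show "partial_order_on ?A (relation_of (\<le>) ?A)"
      by (rule partial_order_on_relation_ofI) auto
  next
    fix C assume "C \<in> Chains (relation_of (\<le>) ?A)"
    then have C: "C \<subseteq> ?A" "\<And>x y. x \<in> C \<Longrightarrow> y \<in> C \<Longrightarrow> x \<le> y \<or> y \<le> x"
      unfolding Chains_def relation_of_def by blast+
    show "\<exists>u\<in>?A. \<forall>x\<in>C. x \<le> u"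
    \<comment> \<open>Directed sets are nonempty, so the empty chain is bounded by \<open>a\<close>
      itself. Any other chain is directed, and Scott-openness keeps its join outside
      \<open>\<kappa>\<close>.\<close>
    proof (cases "C = {}")
      case True
      then show ?thesis
        using a by auto
    next
      case False
      then have "directed C"
        using C(2) unfolding directed_def by (metis order_refl)
      then have "Sup C \<notin> \<kappa>"
        using scott_open_filter_Sup[OF \<kappa>] C(1) by blast
      moreover have "a \<le> Sup C"
        using False C(1) by (metis (mono_tags, lifting) all_not_in_conv mem_Collect_eq Sup_upper2 subsetD)
      ultimately show ?thesis
        by (auto intro: Sup_upper)
    qed
  qed
  then show ?thesis
    using that by (auto intro: order_trans)
qed

lemma maximal_not_in_scott_open_filter_prime:
  fixes p :: "'a::frame"
  assumes \<kappa>: "\<kappa> \<in> scott_open_filters" and p: "p \<notin> \<kappa>"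
    and max: "\<And>b. p \<le> b \<Longrightarrow> b \<notin> \<kappa> \<Longrightarrow> b = p"
    and le: "inf b c \<le> p"
  shows "b \<le> p \<or> c \<le> p"
proof (rule ccontr)
  assume "\<not> (b \<le> p \<or> c \<le> p)"
  then have "sup b p \<in> \<kappa>" "sup c p \<in> \<kappa>"
    using max by (metis sup.cobounded1 sup.cobounded2)+
  then have "inf (sup b p) (sup c p) \<in> \<kappa>"
    by (rule scott_open_filter_inf[OF \<kappa>])
  \<comment> \<open>Distributivity is applied to one factor at a time; every resulting term is below
    \<open>inf b c\<close> or \<open>p\<close>.\<close>
  moreover have "inf (sup b p) c \<le> p"
    using le by (simp add: inf.commute[of _ c] frame_inf_sup_distrib)
  then have "inf (sup b p) (sup c p) \<le> p"
    by (simp add: frame_inf_sup_distrib)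
  ultimately show False
    using scott_open_filter_up[OF \<kappa>] p by blast
qed

text \<open>Primality gives closure under binary meets. Scott-openness holds because a join lies
  below \<open>p\<close> as soon as all members do.\<close>

lemma not_below_prime_scott_open_filter:
  fixes p :: "'a::complete_lattice"
  assumes "p \<noteq> top" and prime: "\<And>b c. inf b c \<le> p \<Longrightarrow> b \<le> p \<or> c \<le> p"
  shows "{b. \<not> b \<le> p} \<in> scott_open_filters"
  using assms unfolding scott_open_filters_def lattice_filter_def
  by (auto simp: top_unique Sup_le_iff dest: order_trans)

context canonical_extension
begin

text \<open>This is density in contrapositive form: \<open>a \<in> \<kappa>\<close> would make
  \<open>e a\<close> an upper bound of the meet over \<open>\<kappa>\<close>.\<close>

lemma ex_filter_not_le:
  assumes "\<not> u \<le> v"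
  obtains \<kappa> a where "\<kappa> \<in> scott_open_filters" "Inf (e ` \<kappa>) \<le> u" "v \<le> e a" "a \<notin> \<kappa>"
  using assms dense_map[of u v] by (metis INF_lower)

lemma prime_separation:
  assumes p: "\<And>b c. inf b c \<le> p \<Longrightarrow> b \<le> p \<or> c \<le> p"
  shows "Inf (e ` {b. \<not> b \<le> p}) \<le> x \<or> x \<le> e p"
proof (rule disjCI)
  assume "\<not> x \<le> e p"
  then obtain \<kappa> a where \<kappa>: "\<kappa> \<in> scott_open_filters" "Inf (e ` \<kappa>) \<le> x" "e p \<le> e a" "a \<notin> \<kappa>"
    by (rule ex_filter_not_le)
  \<comment> \<open>If \<open>p\<close> were in \<open>\<kappa>\<close>, the meet over
    \<open>\<kappa>\<close> would lie below \<open>e p \<le> e a\<close>, and compactness would put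
    \<open>a\<close> in \<open>\<kappa>\<close>.\<close>
  then have "p \<notin> \<kappa>"
    using compact_map by (meson INF_lower order_trans)
  then have "\<kappa> \<subseteq> {b. \<not> b \<le> p}"
    using scott_open_filter_up[OF \<kappa>(1)] by blast
  then have "Inf (e ` {b. \<not> b \<le> p}) \<le> Inf (e ` \<kappa>)"
    by (intro Inf_superset_mono image_mono)
  then show "Inf (e ` {b. \<not> b \<le> p}) \<le> x"
    using \<kappa>(2) by (rule order_trans)
qed

lemma raney_separation:
  fixes u v :: 'b
  assumes "\<not> u \<le> v"
  shows "\<exists>p q. \<not> u \<le> q \<and> \<not> p \<le> v \<and> (\<forall>x. p \<le> x \<or> x \<le> q)"
proof -
  obtain \<kappa> a where \<kappa>: "\<kappa> \<in> scott_open_filters" "Inf (e ` \<kappa>) \<le> u" "v \<le> e a" "a \<notin> \<kappa>"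
    using assms by (rule ex_filter_not_le)
  obtain p where p: "a \<le> p" "p \<notin> \<kappa>" "\<And>b. p \<le> b \<Longrightarrow> b \<notin> \<kappa> \<Longrightarrow> b = p"
    using ex_maximal_not_in_scott_open_filter \<kappa>(1,4) by blast
  have prime: "b \<le> p \<or> c \<le> p" if "inf b c \<le> p" for b c
    using maximal_not_in_scott_open_filter_prime[OF \<kappa>(1) p(2,3) that] by blast
  \<comment> \<open>The meet of \<open>e\<close> over \<open>?\<mu>\<close> is the witness for the
    bound \<open>p\<close> of the goal, and \<open>e p\<close> is the witness for
    \<open>q\<close>.\<close>
  let ?\<mu> = "{b. \<not> b \<le> p}"
  have "p \<noteq> top"
    using p(2) scott_open_filter_top[OF \<kappa>(1)] by blast
  then have "?\<mu> \<in> scott_open_filters"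
    using prime by (rule not_below_prime_scott_open_filter)
  then have "\<not> Inf (e ` ?\<mu>) \<le> e p"
    using compact_map by blast
  moreover have "v \<le> e p"
    using \<kappa>(3) monoD[OF monotone_map p(1)] by (rule order_trans)
  ultimately have "\<not> Inf (e ` ?\<mu>) \<le> v"
    by (meson order_trans)
  \<comment> \<open>Otherwise the meet over \<open>\<kappa>\<close> would lie below
    \<open>e p\<close>, and compactness would force \<open>p\<close> into
    \<open>\<kappa>\<close>.\<close>
  moreover have "\<not> u \<le> e p"
    using compact_map[OF \<kappa>(1)] \<kappa>(2) p(2) by (meson order_trans)
  ultimately show ?thesis
    using prime_separation[OF prime] by blast
qed

end

theorem corollary4p3:
  fixes e :: "'a::locally_compact_frame \<Rightarrow> 'b::complete_lattice"
  assumes "canonical_extension e"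
  shows "class.complete_distrib_lattice
           (Inf :: 'b set \<Rightarrow> 'b) Sup inf (\<le>) (<) sup bot top"
  using canonical_extension.raney_separation[OF assms]
  by (rule complete_distrib_lattice_if_separated)

end
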